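(* Consider the multi-stage stochastic programming (MSSP) model and its non-anticipativity-relaxed problem described in the context. Let $(x^\ast_\omega,y^\ast_\omega)_{\omega\in\Omega}$ be an incumbent (feasible solution) of the non-anticipativity-relaxed problem, and assume that each node in the final stage consists of more than one period. Let $\tilde y$ be a node-wise solution at $x^\ast$, i.e. the operational solution obtained when the inter-node storage-balance constraints are relaxed (see context). Then there exists a non-anticipative solution $(x^\ast_\omega,\hat y_\omega)_{\omega\in\Omega}$ that is feasible for the MSSP model and whose objective function value exceeds that of $(x^\ast_\omega,y^\ast_\omega)_{\omega\in\Omega}$ by at most $$\sum_{r\in\mathcal R}\ \sum_{n\in\mathcal N\setminus\mathcal N_l}\ \sum_{n'\in\overline\mu_n}\frac{\pi_{n'}\,\beta^{(\underline t_{n'}-1)}\,\lambda_{r,\underline t_{n'}}}{\eta^+_r}\,\bigl(\Delta_{r,n,n'}\bigr)^+,$$ where $(\cdot)^+:=\max\{0,\cdot\}$ and $\Delta_{r,n,n'}$ is the residual of the inter-node storage-balance constraint at $\tilde y$: $$\Delta_{r,n,n'}:=\tilde h_{r,1,\underline t_{n'},n'}-\eta_r\,\tilde h_{r,Q,\overline t_n,n}-\eta^+_r\,\tilde h^+_{r,1,\underline t_{n'},n'}+\frac{\tilde h^-_{r,1,\underline t_{n'},n'}}{\eta^-_r}.$$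
   Context: **Sets and tree.** $\Psi$ is the finite set of stages. $\mathcal N=\{0,\ldots,N\}$ is the node set of a finite rooted scenario tree, with root the initialization node $0$, which has a single child (the stage-1 node). All leaves lie in the final stage, and $\mathcal N_l$ denotes the set of leaves. $\mathcal T=\{0,1,\ldots,T\}$ is the set of investment periods. Each node $n$ has a set $\mathcal T_n\subseteq\mathcal T$ of consecutive periods: $\mathcal T_0=\{0\}$, nodes of the same stage have the same $\mathcal T_n$, and along every root-to-leaf path the sets $\mathcal T_n$ partition $\mathcal T$ in increasing order (so $T\in\mathcal T_n$ for every leaf $n$). $\underline t_n$ and $\overline t_n$ are the first and last periods of $\mathcal T_n$, and $\overline\mu_n$ is the set of immediate children of $n$. $\mathcal Q=\{1,\ldots,Q\}$ is the set of sub-periods in each period. $\mathcal R=\{\text{electricity},\text{heat}\}$. $\mathcal J,\mathcal S,\mathcal A$ are pairwise disjoint finite sets of generation, storage and heat-transfer technologies, and $\mathcal U=\mathcal J\cup\mathcal S\cup\mathcal A$. With $\tau_{u,t}$ the lifetime of technology $u$ installed in period $t$, $\mathcal T'_{u,[t')}=\{t\in\mathcal T: t\le t'<t+\tau_{u,t}\}$. For a node $n$ and a period $t$ not later than the last period of $n$, $\mu_{t,n}$ is the node on the path from node $0$ to $n$ (inclusive) whose period set contains $t$. $\kappa_{q,t,n}$ is the (sub-period, period, node) triple immediately preceding $(q,t,n)$: it is $(q-1,t,n)$ if $q\ge2$; $(Q,t-1,n)$ if $q=1$ and $t-1\in\mathcal T_n$; and $(Q,t-1,\text{parent of }n)$ if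 $q=1$ and $t-1\notin\mathcal T_n$. **Parameters** (real numbers): discount factor $\beta>0$; installation costs $\alpha_{u,n}>0$; O&M costs $\hat\alpha_{u,t}\ge0$; purchase costs $\lambda_{r,t}\ge0$; demands $\delta_{r,q,t}\ge0$; generation $\Gamma_{j,r,q,t,t',n}\ge0$; storage capacities $\upsilon_{s,r,t,t'}\ge0$; heat-transfer capacities $\varphi_a\ge0$; degradation rates $\sigma_{u,t,t'}\in[0,1]$; charging/discharging efficiencies $\eta^+_r,\eta^-_r\in(0,1)$; self-discharge (retention) factor $\eta_r\in(0,1)$; coefficients of performance $\mathrm{cop}_{a,q,t,n}>0$; footprints $\rho_{u,t}\ge0$; initial installations $\iota_u\in\mathbb Z_+$; fractions $\gamma_r\ge0$; budgets $\phi_t\ge0$; areas $\varkappa_t\ge0$. Define $\mathbb 1_{a,r,q,t,t',n}=1-\sigma_{a,t,t'}$ if $r=\text{heat}$ and $\mathbb 1_{a,r,q,t,t',n}=-1/\mathrm{cop}_{a,q,t,n}$ if $r=\text{electricity}$. $\Omega$ is the set of scenario paths (paths from node $0$ to a leaf), with probabilities $\Pi_\omega\ge0$, $\sum_\omega\Pi_\omega=1$, and the node probability is $\pi_n=\sum_{\omega\in\Omega:\,n\in\omega}\Pi_\omega$. **MSSP model.** Variables: investments $x_{u,t,n}\in\mathbb Z_+$; operational variables $p_{r,q,t,n}$ (exogenous purchase), $h_{r,q,t,n}$ (stored energy), $h^+_{r,q,t,n}$ (charging), $h^-_{r,q,t,n}$ (discharging), $o_{r,q,t,n}$ (energy used from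 inventory and generation), $m_{a,q,t,t',n}$ (heat transferred in sub-period $q$ of period $t'\in\mathcal T_n$ by technology $a$ installed in period $t\in\mathcal T'_{a,[t')}$), all in $\mathbb R_+$. Minimize $$\sum_{n\in\mathcal N\setminus\{0\}}\sum_{t\in\mathcal T_n}\pi_n\beta^{t-1}\Big(\sum_{u\in\mathcal U}(\alpha_{u,n}+\hat\alpha_{u,t})x_{u,t,n}+\sum_{r\in\mathcal R}\sum_{q\in\mathcal Q}\lambda_{r,t}p_{r,q,t,n}\Big)$$ subject to: (1) $o_{r,q,t',n}+\sum_{a\in\mathcal A}\sum_{t\in\mathcal T'_{a,[t')}}\mathbb 1_{a,r,q,t,t',n}\,m_{a,q,t,t',n}\ge\delta_{r,q,t'}$ for $n\in\mathcal N\setminus\{0\}$, $t'\in\mathcal T_n$, $q\in\mathcal Q$, $r\in\mathcal R$; (2) $p_{r,q,t',n}-h^+_{r,q,t',n}+h^-_{r,q,t',n}+\sum_{j\in\mathcal J}\sum_{t\in\mathcal T'_{j,[t')}}\Gamma_{j,r,q,t,t',n}x_{j,t,\mu_{t,n}}\ge o_{r,q,t',n}$ for $n\in\mathcal N\setminus\{0\}$, $t'\in\mathcal T_n$, $q\in\mathcal Q$, $r\in\mathcal R$; (3) (storage balance) $h_{r,q,t',n}=\eta_r h_{r,\kappa_{q,t',n}}+\eta^+_r h^+_{r,q,t',n}-h^-_{r,q,t',n}/\eta^-_r$ for $n\in\mathcal N\setminus\{0\}$, $t'\in\mathcal T_n$, $q\in\mathcal Q$, $r\in\mathcal R$; (4)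 $h_{r,q,t',n}\le\sum_{s\in\mathcal S}\sum_{t\in\mathcal T'_{s,[t')}}\upsilon_{s,r,t,t'}x_{s,t,\mu_{t,n}}$ for $n\in\mathcal N$, $t'\in\mathcal T_n$, $q\in\mathcal Q$, $r\in\mathcal R$; (5) $m_{a,q,t,t',n}\le\varphi_a x_{a,t,\mu_{t,n}}$ for $n\in\mathcal N$, $t'\in\mathcal T_n$, $a\in\mathcal A$, $t\in\mathcal T'_{a,[t')}$, $q\in\mathcal Q$; (6) $\sum_{q\in\mathcal Q}p_{r,q,T,n}\le\gamma_r\sum_{q\in\mathcal Q}\delta_{r,q,T}$ for $n\in\mathcal N_l$, $r\in\mathcal R$; (7) $\sum_{u\in\mathcal U}\alpha_{u,n}x_{u,t,n}\le\phi_t$ for $n\in\mathcal N\setminus\{0\}$, $t\in\mathcal T_n$; (8) $\sum_{u\in\mathcal U}\sum_{t\in\mathcal T'_{u,[t')}}\rho_{u,t}x_{u,t,\mu_{t,n}}\le\varkappa_{t'}$ for $n\in\mathcal N\setminus\{0\}$, $t'\in\mathcal T_n$; (9) $x_{u,0,0}=\iota_u$ for $u\in\mathcal U$; (10) $x_{u,t,n}\le\lfloor\phi_t/\alpha_{u,n}\rfloor$ for $n\in\mathcal N$, $t\in\mathcal T_n$, $u\in\mathcal U$. **Non-anticipativity-relaxed problem.** For each path $\omega\in\Omega$ there is a copy $x_\omega$ of the investment variables and a copy $y_\omega$ of the operational variables $(p,h,h^+,h^-,o,m)$ on the nodes of $\omega$. The investment copies $(x_\omega)_\omega$ are required to be non-anticipative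 (two paths through a common node have identical investment decisions at that node) and to satisfy (7)–(10) and integrality. The operational copies of different paths are not required to agree at shared nodes. For each $\omega$, $(x_\omega,y_\omega)$ must satisfy constraints (1)–(6) and nonnegativity restricted to the nodes of $\omega$ (where (3) uses the values in $y_\omega$). The objective is $\sum_{\omega\in\Omega}\Pi_\omega(c_\omega^\top x_\omega+d_\omega^\top y_\omega)$, where $c_\omega^\top x_\omega+d_\omega^\top y_\omega=\sum_{n\in\omega\setminus\{0\}}\sum_{t\in\mathcal T_n}\beta^{t-1}\big(\sum_{u}(\alpha_{u,n}+\hat\alpha_{u,t})x_{u,t,n}+\sum_{r,q}\lambda_{r,t}p_{r,q,t,n}\big)$ evaluated at the copies of path $\omega$. An incumbent is a feasible solution of this problem. A solution $(x_\omega,y_\omega)_{\omega\in\Omega}$ is non-anticipative if both investment and operational decisions of any two paths agree at every node they share; such a solution is identified with a single assignment of variables to the nodes of the tree, and its feasibility and objective value are those of the MSSP model. **Node-wise solution.** The inter-node storage-balance constraints are the constraints (3) with $q=1$, $t'=\underline t_{n'}$ and node $n'\ne0$, which couple the last sub-period of the last period of the parent $n$ to the first sub-period of $n'\in\overline\mu_n$. When these are dropped and the investments are fixed at $x^\ast$, the operational problem separates into one linear program for each node $n\in\mathcal N$: minimize the purchase cost $\sum_{t\in\mathcal T_n}\sum_{r,q}\beta^{t-1}\lambda_{r,t}p_{r,q,t,n}$ (zero for $n=0$) over the operational variables of node $n$, subject to all constraints among (1)–(6) and nonnegativity pertaining to node $n$, where of (3) only the within-node balances are retained. $\tilde y$ (with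 components $\tilde p,\tilde h,\tilde h^+,\tilde h^-,\tilde o,\tilde m$) denotes the collection of optimal solutions of these node-wise problems. *)

theory Defs
  imports Complex_Main
begin

datatype resource = Electricity | Heat

lemma UNIV_resource: "UNIV = {Electricity, Heat}"
  using resource.exhaust by auto

instance resource :: finite
  by standard (simp add: UNIV_resource)

(* Arguments appear in the order of the subscripts in the model, e.g. generation M j r q t t' n.
   A scenario path is represented by its set of nodes (their order is the tree order), so that
   scenario_prob takes a set of nodes.  The value of parent at the root is irrelevant. *)

record 'u mssp_data =
  num_stages :: nat
  max_node :: nat
  parent :: "nat \<Rightarrow> nat"
  stage :: "nat \<Rightarrow> nat"
  horizon :: nat
  node_periods :: "nat \<Rightarrow> nat set"
  num_subperiods :: nat
  gen_techs :: "'u set"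
  stor_techs :: "'u set"
  heat_techs :: "'u set"
  lifetime :: "'u \<Rightarrow> nat \<Rightarrow> real"
  discount :: real
  inst_cost :: "'u \<Rightarrow> nat \<Rightarrow> real"
  om_cost :: "'u \<Rightarrow> nat \<Rightarrow> real"
  price :: "resource \<Rightarrow> nat \<Rightarrow> real"
  demand :: "resource \<Rightarrow> nat \<Rightarrow> nat \<Rightarrow> real"
  generation :: "'u \<Rightarrow> resource \<Rightarrow> nat \<Rightarrow> nat \<Rightarrow> nat \<Rightarrow> nat \<Rightarrow> real"
  stor_cap :: "'u \<Rightarrow> resource \<Rightarrow> nat \<Rightarrow> nat \<Rightarrow> real"
  transfer_cap :: "'u \<Rightarrow> real"
  degradation :: "'u \<Rightarrow> nat \<Rightarrow> nat \<Rightarrow> real"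
  charge_eff :: "resource \<Rightarrow> real"
  discharge_eff :: "resource \<Rightarrow> real"
  retention :: "resource \<Rightarrow> real"
  cop :: "'u \<Rightarrow> nat \<Rightarrow> nat \<Rightarrow> nat \<Rightarrow> real"
  footprint :: "'u \<Rightarrow> nat \<Rightarrow> real"
  initial_inst :: "'u \<Rightarrow> nat"
  purchase_frac :: "resource \<Rightarrow> real"
  budget :: "nat \<Rightarrow> real"
  area :: "nat \<Rightarrow> real"
  scenario_prob :: "nat set \<Rightarrow> real"

definition nodes :: "'u mssp_data \<Rightarrow> nat set" where
  "nodes M = {0..max_node M}"

definition periods :: "'u mssp_data \<Rightarrow> nat set" where
  "periods M = {0..horizon M}"

definition subperiods :: "'u mssp_data \<Rightarrow> nat set" where
  "subperiods M = {1..num_subperiods M}"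

definition techs :: "'u mssp_data \<Rightarrow> 'u set" where
  "techs M = gen_techs M \<union> stor_techs M \<union> heat_techs M"

definition edges :: "'u mssp_data \<Rightarrow> (nat \<times> nat) set" where
  "edges M = {(parent M n, n) | n. n \<in> nodes M - {0}}"

definition children :: "'u mssp_data \<Rightarrow> nat \<Rightarrow> nat set" where
  "children M n = edges M `` {n}"

definition leaves :: "'u mssp_data \<Rightarrow> nat set" where
  "leaves M = {n \<in> nodes M. children M n = {}}"

definition path_to :: "'u mssp_data \<Rightarrow> nat \<Rightarrow> nat set" where
  "path_to M n = {k. (k, n) \<in> (edges M)\<^sup>*}"

definition scenarios :: "'u mssp_data \<Rightarrow> nat set set" where
  "scenarios M = path_to M ` leaves M"

definition node_prob :: "'u mssp_data \<Rightarrow> nat \<Rightarrow> real" where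
  "node_prob M n = (\<Sum>\<omega>\<in>{\<omega> \<in> scenarios M. n \<in> \<omega>}. scenario_prob M \<omega>)"

definition first_period :: "'u mssp_data \<Rightarrow> nat \<Rightarrow> nat" where
  "first_period M n = Min (node_periods M n)"

definition last_period :: "'u mssp_data \<Rightarrow> nat \<Rightarrow> nat" where
  "last_period M n = Max (node_periods M n)"

definition active :: "'u mssp_data \<Rightarrow> 'u \<Rightarrow> nat \<Rightarrow> nat set" where
  "active M u t' = {t \<in> periods M. t \<le> t' \<and> real t' < real t + lifetime M u t}"

definition node_at :: "'u mssp_data \<Rightarrow> nat \<Rightarrow> nat \<Rightarrow> nat" where
  "node_at M t n = (THE k. k \<in> path_to M n \<and> t \<in> node_periods M k)"

(* Only used at nodes other than the root, whose periods are at least 1, so that t - 1 is the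
   true predecessor; likewise for the exponent of the discount factor below. *)
definition preceding :: "'u mssp_data \<Rightarrow> nat \<Rightarrow> nat \<Rightarrow> nat \<Rightarrow> nat \<times> nat \<times> nat" where
  "preceding M q t n =
     (if 2 \<le> q then (q - 1, t, n)
      else if t - 1 \<in> node_periods M n then (num_subperiods M, t - 1, n)
      else (num_subperiods M, t - 1, parent M n))"

definition transfer_coeff ::
  "'u mssp_data \<Rightarrow> 'u \<Rightarrow> resource \<Rightarrow> nat \<Rightarrow> nat \<Rightarrow> nat \<Rightarrow> nat \<Rightarrow> real" where
  "transfer_coeff M a r q t t' n =
     (case r of Heat \<Rightarrow> 1 - degradation M a t t' | Electricity \<Rightarrow> - 1 / cop M a q t n)"

(* Disjointness of the period sets along a path is implied by their being increasing. *)
definition scenario_tree :: "'u mssp_data \<Rightarrow> bool" where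
  "scenario_tree M \<longleftrightarrow>
     (\<forall>n\<in>nodes M - {0}. parent M n \<in> nodes M) \<and>
     (\<forall>n\<in>nodes M. (0, n) \<in> (edges M)\<^sup>*) \<and>
     card (children M 0) = 1 \<and>
     stage M 0 = 0 \<and>
     (\<forall>n\<in>nodes M - {0}. stage M n = Suc (stage M (parent M n))) \<and>
     (\<forall>n\<in>leaves M. stage M n = num_stages M) \<and>
     node_periods M 0 = {0} \<and>
     (\<forall>n\<in>nodes M. \<exists>a b. a \<le> b \<and> node_periods M n = {a..b}) \<and>
     (\<forall>n\<in>nodes M. \<forall>n'\<in>nodes M. stage M n = stage M n' \<longrightarrow> node_periods M n = node_periods M n') \<and>
     (\<forall>l\<in>leaves M. (\<Union>n\<in>path_to M l. node_periods M n) = periods M) \<and>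
     (\<forall>k\<in>nodes M. \<forall>n\<in>nodes M. (k, n) \<in> (edges M)\<^sup>+ \<longrightarrow>
        (\<forall>s\<in>node_periods M k. \<forall>t\<in>node_periods M n. s < t))"

definition valid_parameters :: "'u mssp_data \<Rightarrow> bool" where
  "valid_parameters M \<longleftrightarrow>
     1 \<le> num_subperiods M \<and>
     finite (gen_techs M) \<and> finite (stor_techs M) \<and> finite (heat_techs M) \<and>
     gen_techs M \<inter> stor_techs M = {} \<and> gen_techs M \<inter> heat_techs M = {} \<and>
     stor_techs M \<inter> heat_techs M = {} \<and>
     0 < discount M \<and>
     (\<forall>u\<in>techs M. \<forall>n\<in>nodes M. 0 < inst_cost M u n) \<and>
     (\<forall>u\<in>techs M. \<forall>t\<in>periods M. 0 \<le> om_cost M u t \<and> 0 \<le> footprint M u t) \<and>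
     (\<forall>r. \<forall>t\<in>periods M. 0 \<le> price M r t) \<and>
     (\<forall>r. \<forall>q\<in>subperiods M. \<forall>t\<in>periods M. 0 \<le> demand M r q t) \<and>
     (\<forall>j\<in>gen_techs M. \<forall>r. \<forall>q\<in>subperiods M. \<forall>t\<in>periods M. \<forall>t'\<in>periods M. \<forall>n\<in>nodes M.
        0 \<le> generation M j r q t t' n) \<and>
     (\<forall>s\<in>stor_techs M. \<forall>r. \<forall>t\<in>periods M. \<forall>t'\<in>periods M. 0 \<le> stor_cap M s r t t') \<and>
     (\<forall>a\<in>heat_techs M. 0 \<le> transfer_cap M a) \<and>
     (\<forall>u\<in>techs M. \<forall>t\<in>periods M. \<forall>t'\<in>periods M. degradation M u t t' \<in> {0..1}) \<and>
     (\<forall>r. charge_eff M r \<in> {0<..<1} \<and> discharge_eff M r \<in> {0<..<1} \<and>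
        retention M r \<in> {0<..<1} \<and> 0 \<le> purchase_frac M r) \<and>
     (\<forall>a\<in>heat_techs M. \<forall>q\<in>subperiods M. \<forall>t\<in>periods M. \<forall>n\<in>nodes M. 0 < cop M a q t n) \<and>
     (\<forall>t\<in>periods M. 0 \<le> budget M t \<and> 0 \<le> area M t) \<and>
     (\<forall>\<omega>\<in>scenarios M. 0 \<le> scenario_prob M \<omega>) \<and>
     (\<Sum>\<omega>\<in>scenarios M. scenario_prob M \<omega>) = 1"

definition mssp_instance :: "'u mssp_data \<Rightarrow> bool" where
  "mssp_instance M \<longleftrightarrow> scenario_tree M \<and> valid_parameters M"


(* x u t n; the nonnegativity and integrality restrictions are carried by the type *)
type_synonym 'u investment = "'u \<Rightarrow> nat \<Rightarrow> nat \<Rightarrow> nat"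

(* Only entries at indices occurring in the model are meaningful. *)
record 'u operation =
  purchase :: "resource \<Rightarrow> nat \<Rightarrow> nat \<Rightarrow> nat \<Rightarrow> real"
  stored :: "resource \<Rightarrow> nat \<Rightarrow> nat \<Rightarrow> nat \<Rightarrow> real"
  charge :: "resource \<Rightarrow> nat \<Rightarrow> nat \<Rightarrow> nat \<Rightarrow> real"
  discharge :: "resource \<Rightarrow> nat \<Rightarrow> nat \<Rightarrow> nat \<Rightarrow> real"
  used :: "resource \<Rightarrow> nat \<Rightarrow> nat \<Rightarrow> nat \<Rightarrow> real"
  transfer :: "'u \<Rightarrow> nat \<Rightarrow> nat \<Rightarrow> nat \<Rightarrow> nat \<Rightarrow> real"

definition op_nonneg :: "'u mssp_data \<Rightarrow> 'u operation \<Rightarrow> nat \<Rightarrow> bool" where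
  "op_nonneg M y n \<longleftrightarrow>
     (\<forall>r. \<forall>q\<in>subperiods M. \<forall>t\<in>node_periods M n.
        0 \<le> purchase y r q t n \<and> 0 \<le> stored y r q t n \<and> 0 \<le> charge y r q t n \<and>
        0 \<le> discharge y r q t n \<and> 0 \<le> used y r q t n) \<and>
     (\<forall>a\<in>heat_techs M. \<forall>q\<in>subperiods M. \<forall>t'\<in>node_periods M n. \<forall>t\<in>active M a t'.
        0 \<le> transfer y a q t t' n)"

definition demand_met :: "'u mssp_data \<Rightarrow> 'u operation \<Rightarrow> nat \<Rightarrow> bool" where
  "demand_met M y n \<longleftrightarrow>
     (\<forall>t'\<in>node_periods M n. \<forall>q\<in>subperiods M. \<forall>r.
        used y r q t' n
          + (\<Sum>a\<in>heat_techs M. \<Sum>t\<in>active M a t'.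
               transfer_coeff M a r q t t' n * transfer y a q t t' n)
        \<ge> demand M r q t')"

definition supply_met :: "'u mssp_data \<Rightarrow> 'u investment \<Rightarrow> 'u operation \<Rightarrow> nat \<Rightarrow> bool" where
  "supply_met M x y n \<longleftrightarrow>
     (\<forall>t'\<in>node_periods M n. \<forall>q\<in>subperiods M. \<forall>r.
        purchase y r q t' n - charge y r q t' n + discharge y r q t' n
          + (\<Sum>j\<in>gen_techs M. \<Sum>t\<in>active M j t'.
               generation M j r q t t' n * real (x j t (node_at M t n)))
        \<ge> used y r q t' n)"

definition balance_at :: "'u mssp_data \<Rightarrow> 'u operation \<Rightarrow> resource \<Rightarrow> nat \<Rightarrow> nat \<Rightarrow> nat \<Rightarrow> bool" where
  "balance_at M y r q t' n \<longleftrightarrow>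
     stored y r q t' n =
       retention M r * (case preceding M q t' n of (q0, t0, n0) \<Rightarrow> stored y r q0 t0 n0)
       + charge_eff M r * charge y r q t' n - discharge y r q t' n / discharge_eff M r"

definition storage_balance :: "'u mssp_data \<Rightarrow> 'u operation \<Rightarrow> nat \<Rightarrow> bool" where
  "storage_balance M y n \<longleftrightarrow>
     (\<forall>t'\<in>node_periods M n. \<forall>q\<in>subperiods M. \<forall>r. balance_at M y r q t' n)"

definition inner_storage_balance :: "'u mssp_data \<Rightarrow> 'u operation \<Rightarrow> nat \<Rightarrow> bool" where
  "inner_storage_balance M y n \<longleftrightarrow>
     (\<forall>t'\<in>node_periods M n. \<forall>q\<in>subperiods M. \<forall>r.
        \<not> (q = 1 \<and> t' = first_period M n) \<longrightarrow> balance_at M y r q t' n)"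

definition storage_capacity :: "'u mssp_data \<Rightarrow> 'u investment \<Rightarrow> 'u operation \<Rightarrow> nat \<Rightarrow> bool" where
  "storage_capacity M x y n \<longleftrightarrow>
     (\<forall>t'\<in>node_periods M n. \<forall>q\<in>subperiods M. \<forall>r.
        stored y r q t' n \<le>
          (\<Sum>s\<in>stor_techs M. \<Sum>t\<in>active M s t'.
             stor_cap M s r t t' * real (x s t (node_at M t n))))"

definition transfer_capacity :: "'u mssp_data \<Rightarrow> 'u investment \<Rightarrow> 'u operation \<Rightarrow> nat \<Rightarrow> bool" where
  "transfer_capacity M x y n \<longleftrightarrow>
     (\<forall>t'\<in>node_periods M n. \<forall>a\<in>heat_techs M. \<forall>t\<in>active M a t'. \<forall>q\<in>subperiods M.
        transfer y a q t t' n \<le> transfer_cap M a * real (x a t (node_at M t n)))"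

definition purchase_limit :: "'u mssp_data \<Rightarrow> 'u operation \<Rightarrow> nat \<Rightarrow> bool" where
  "purchase_limit M y n \<longleftrightarrow>
     (\<forall>r. (\<Sum>q\<in>subperiods M. purchase y r q (horizon M) n)
          \<le> purchase_frac M r * (\<Sum>q\<in>subperiods M. demand M r q (horizon M)))"

(* The operational constraints pertaining to node n, except for the storage balance. *)
definition node_constraints :: "'u mssp_data \<Rightarrow> 'u investment \<Rightarrow> 'u operation \<Rightarrow> nat \<Rightarrow> bool" where
  "node_constraints M x y n \<longleftrightarrow>
     op_nonneg M y n \<and>
     (n \<noteq> 0 \<longrightarrow> demand_met M y n \<and> supply_met M x y n) \<and>
     storage_capacity M x y n \<and>
     transfer_capacity M x y n \<and>
     (n \<in> leaves M \<longrightarrow> purchase_limit M y n)"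

definition op_feasible :: "'u mssp_data \<Rightarrow> nat set \<Rightarrow> 'u investment \<Rightarrow> 'u operation \<Rightarrow> bool" where
  "op_feasible M W x y \<longleftrightarrow>
     (\<forall>n\<in>W. node_constraints M x y n \<and> (n \<noteq> 0 \<longrightarrow> storage_balance M y n))"

definition inv_feasible :: "'u mssp_data \<Rightarrow> nat set \<Rightarrow> 'u investment \<Rightarrow> bool" where
  "inv_feasible M W x \<longleftrightarrow>
     (\<forall>n\<in>W - {0}. \<forall>t\<in>node_periods M n.
        (\<Sum>u\<in>techs M. inst_cost M u n * real (x u t n)) \<le> budget M t) \<and>
     (\<forall>n\<in>W - {0}. \<forall>t'\<in>node_periods M n.
        (\<Sum>u\<in>techs M. \<Sum>t\<in>active M u t'. footprint M u t * real (x u t (node_at M t n)))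
          \<le> area M t') \<and>
     (\<forall>u\<in>techs M. x u 0 0 = initial_inst M u) \<and>
     (\<forall>n\<in>W. \<forall>t\<in>node_periods M n. \<forall>u\<in>techs M. int (x u t n) \<le> \<lfloor>budget M t / inst_cost M u n\<rfloor>)"

definition period_cost ::
  "'u mssp_data \<Rightarrow> 'u investment \<Rightarrow> 'u operation \<Rightarrow> nat \<Rightarrow> nat \<Rightarrow> real" where
  "period_cost M x y t n =
     (\<Sum>u\<in>techs M. (inst_cost M u n + om_cost M u t) * real (x u t n))
     + (\<Sum>r\<in>UNIV. \<Sum>q\<in>subperiods M. price M r t * purchase y r q t n)"

definition mssp_feasible :: "'u mssp_data \<Rightarrow> 'u investment \<Rightarrow> 'u operation \<Rightarrow> bool" where
  "mssp_feasible M x y \<longleftrightarrow> inv_feasible M (nodes M) x \<and> op_feasible M (nodes M) x y"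

definition mssp_objective :: "'u mssp_data \<Rightarrow> 'u investment \<Rightarrow> 'u operation \<Rightarrow> real" where
  "mssp_objective M x y =
     (\<Sum>n\<in>nodes M - {0}. \<Sum>t\<in>node_periods M n.
        node_prob M n * discount M ^ (t - 1) * period_cost M x y t n)"


(* Path copies are functions of the path; the copy of a path is only constrained, and only
   contributes to the objective, at the nodes of that path. *)

definition inv_nonanticipative :: "'u mssp_data \<Rightarrow> (nat set \<Rightarrow> 'u investment) \<Rightarrow> bool" where
  "inv_nonanticipative M xs \<longleftrightarrow>
     (\<forall>\<omega>\<in>scenarios M. \<forall>\<omega>'\<in>scenarios M. \<forall>n\<in>\<omega> \<inter> \<omega>'. \<forall>t\<in>node_periods M n. \<forall>u\<in>techs M.
        xs \<omega> u t n = xs \<omega>' u t n)"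

definition op_nonanticipative :: "'u mssp_data \<Rightarrow> (nat set \<Rightarrow> 'u operation) \<Rightarrow> bool" where
  "op_nonanticipative M ys \<longleftrightarrow>
     (\<forall>\<omega>\<in>scenarios M. \<forall>\<omega>'\<in>scenarios M. \<forall>n\<in>\<omega> \<inter> \<omega>'. \<forall>t'\<in>node_periods M n. \<forall>q\<in>subperiods M.
        (\<forall>r. purchase (ys \<omega>) r q t' n = purchase (ys \<omega>') r q t' n \<and>
             stored (ys \<omega>) r q t' n = stored (ys \<omega>') r q t' n \<and>
             charge (ys \<omega>) r q t' n = charge (ys \<omega>') r q t' n \<and>
             discharge (ys \<omega>) r q t' n = discharge (ys \<omega>') r q t' n \<and>
             used (ys \<omega>) r q t' n = used (ys \<omega>') r q t' n) \<and>
        (\<forall>a\<in>heat_techs M. \<forall>t\<in>active M a t'.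
             transfer (ys \<omega>) a q t t' n = transfer (ys \<omega>') a q t t' n))"

definition nonanticipative ::
  "'u mssp_data \<Rightarrow> (nat set \<Rightarrow> 'u investment) \<Rightarrow> (nat set \<Rightarrow> 'u operation) \<Rightarrow> bool" where
  "nonanticipative M xs ys \<longleftrightarrow> inv_nonanticipative M xs \<and> op_nonanticipative M ys"

definition relaxed_feasible ::
  "'u mssp_data \<Rightarrow> (nat set \<Rightarrow> 'u investment) \<Rightarrow> (nat set \<Rightarrow> 'u operation) \<Rightarrow> bool" where
  "relaxed_feasible M xs ys \<longleftrightarrow>
     inv_nonanticipative M xs \<and>
     (\<forall>\<omega>\<in>scenarios M. inv_feasible M \<omega> (xs \<omega>) \<and> op_feasible M \<omega> (xs \<omega>) (ys \<omega>))"

definition path_objective ::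
  "'u mssp_data \<Rightarrow> nat set \<Rightarrow> 'u investment \<Rightarrow> 'u operation \<Rightarrow> real" where
  "path_objective M \<omega> x y =
     (\<Sum>n\<in>\<omega> - {0}. \<Sum>t\<in>node_periods M n. discount M ^ (t - 1) * period_cost M x y t n)"

definition relaxed_objective ::
  "'u mssp_data \<Rightarrow> (nat set \<Rightarrow> 'u investment) \<Rightarrow> (nat set \<Rightarrow> 'u operation) \<Rightarrow> real" where
  "relaxed_objective M xs ys =
     (\<Sum>\<omega>\<in>scenarios M. scenario_prob M \<omega> * path_objective M \<omega> (xs \<omega>) (ys \<omega>))"

(* The single assignment to the nodes of the tree with which a non-anticipative family of path
   copies is identified: at node n it takes the value of the copy of any path through n. By
   non-anticipativity the choice of the path does not matter. *)

definition path_through :: "'u mssp_data \<Rightarrow> nat \<Rightarrow> nat set" where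
  "path_through M n = (SOME \<omega>. \<omega> \<in> scenarios M \<and> n \<in> \<omega>)"

definition tree_inv :: "'u mssp_data \<Rightarrow> (nat set \<Rightarrow> 'u investment) \<Rightarrow> 'u investment" where
  "tree_inv M xs = (\<lambda>u t n. xs (path_through M n) u t n)"

definition tree_op :: "'u mssp_data \<Rightarrow> (nat set \<Rightarrow> 'u operation) \<Rightarrow> 'u operation" where
  "tree_op M ys =
     \<lparr> purchase = (\<lambda>r q t n. purchase (ys (path_through M n)) r q t n),
       stored = (\<lambda>r q t n. stored (ys (path_through M n)) r q t n),
       charge = (\<lambda>r q t n. charge (ys (path_through M n)) r q t n),
       discharge = (\<lambda>r q t n. discharge (ys (path_through M n)) r q t n),
       used = (\<lambda>r q t n. used (ys (path_through M n)) r q t n),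
       transfer = (\<lambda>a q t t' n. transfer (ys (path_through M n)) a q t t' n) \<rparr>"


(* The node problem is stated on a full operational record, of which it only involves the
   components at node n. *)

definition node_feasible :: "'u mssp_data \<Rightarrow> 'u investment \<Rightarrow> nat \<Rightarrow> 'u operation \<Rightarrow> bool" where
  "node_feasible M x n y \<longleftrightarrow>
     node_constraints M x y n \<and> (n \<noteq> 0 \<longrightarrow> inner_storage_balance M y n)"

definition node_cost :: "'u mssp_data \<Rightarrow> nat \<Rightarrow> 'u operation \<Rightarrow> real" where
  "node_cost M n y =
     (if n = 0 then 0
      else \<Sum>t\<in>node_periods M n. \<Sum>r\<in>UNIV. \<Sum>q\<in>subperiods M.
             discount M ^ (t - 1) * price M r t * purchase y r q t n)"

definition nodewise_solution :: "'u mssp_data \<Rightarrow> 'u investment \<Rightarrow> 'u operation \<Rightarrow> bool" where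
  "nodewise_solution M x y \<longleftrightarrow>
     (\<forall>n\<in>nodes M. node_feasible M x n y \<and>
        (\<forall>y'. node_feasible M x n y' \<longrightarrow> node_cost M n y \<le> node_cost M n y'))"

definition balance_residual :: "'u mssp_data \<Rightarrow> 'u operation \<Rightarrow> resource \<Rightarrow> nat \<Rightarrow> nat \<Rightarrow> real" where
  "balance_residual M y r n n' =
     stored y r 1 (first_period M n') n'
     - retention M r * stored y r (num_subperiods M) (last_period M n) n
     - charge_eff M r * charge y r 1 (first_period M n') n'
     + discharge y r 1 (first_period M n') n' / discharge_eff M r"

end

theory Submission
  imports Defs
begin

text \<open>The node-wise solution satisfies every operational constraint of the tree model except the
  storage balance at the first sub-period of each node other than the root. A violation there can be repaired
  locally, without changing any storage level: if the residual \<open>\<Delta>\<close> is positive, the missing energy is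
  charged from an additional purchase of \<open>\<Delta> / \<eta>\<^sup>+\<close>; if it is negative, the surplus is discharged, which
  costs nothing because the supply constraint is an inequality and discharging is not bounded above
  (\<open>repair_storage_balance\<close>, \<open>repair_node_constraints\<close>). The purchase limit concerns only the last
  period of a leaf, which is not its first period as a leaf has several periods. The repair
  therefore costs exactly the claimed bound (\<open>repair_objective\<close>).

  It remains to see that the node-wise solution is not more expensive than the incumbent
  (\<open>nodewise_objective_le\<close>). The operational decisions of each path copy are feasible for the
  node-wise problem at every node of the path, so there they cost at least as much as the node-wise
  optimum. Averaging over the paths through each node, whose probabilities add up to the node
  probability, and summing over the nodes gives the inequality; the investment costs agree on both
  sides by non-anticipativity.

  The constraints at a node refer to investments made at the ancestor covering a given period. That
  this ancestor exists and is unique (\<open>ex_node_at\<close>), and that the last period of the parent immediately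
  precedes the first period of a node (\<open>parent_last_period\<close>), follows from the period sets
  partitioning the horizon in increasing order along each path to a leaf.\<close>

section \<open>Paths and periods in a scenario tree\<close>

lemma edges_iff: "(k, n) \<in> edges M \<longleftrightarrow> n \<in> nodes M \<and> n \<noteq> 0 \<and> k = parent M n"
  by (auto simp: edges_def)

lemma children_eq: "children M n = {n' \<in> nodes M - {0}. parent M n' = n}"
  by (auto simp: children_def edges_def)

lemma finite_nodes: "finite (nodes M)"
  by (simp add: nodes_def)

lemma finite_scenarios: "finite (scenarios M)"
  by (simp add: scenarios_def leaves_def finite_nodes)

lemma path_to_self: "n \<in> path_to M n"
  by (simp add: path_to_def)

lemma path_to_trans: "k \<in> path_to M m \<Longrightarrow> m \<in> path_to M n \<Longrightarrow> k \<in> path_to M n"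
  unfolding path_to_def by (auto intro: rtrancl_trans)

lemma path_to_parent:
  assumes "k \<in> path_to M n" "k \<noteq> n"
  shows "k \<in> path_to M (parent M n)" "n \<in> nodes M" "n \<noteq> 0"
proof -
  have "(k, n) \<in> (edges M)\<^sup>*" using assms(1) by (simp add: path_to_def)
  then obtain m where "(k, m) \<in> (edges M)\<^sup>*" "(m, n) \<in> edges M"
    using assms(2) by (cases rule: rtranclE) auto
  then show "k \<in> path_to M (parent M n)" "n \<in> nodes M" "n \<noteq> 0"
    by (simp_all add: path_to_def edges_iff)
qed

lemma path_to_linear:
  assumes "a \<in> path_to M n" "b \<in> path_to M n"
  shows "a \<in> path_to M b \<or> b \<in> path_to M a"
proof -
  have sv: "single_valued ((edges M)\<inverse>)"
    by (auto simp: single_valued_def edges_iff)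
  have "(n, a) \<in> ((edges M)\<inverse>)\<^sup>*" "(n, b) \<in> ((edges M)\<inverse>)\<^sup>*"
    using assms by (auto simp: path_to_def rtrancl_converse)
  from single_valued_confluent[OF sv this] show ?thesis
    by (auto simp: path_to_def rtrancl_converse)
qed

lemma scenario_treeD:
  assumes "scenario_tree M"
  shows parent_in_nodes: "n \<in> nodes M \<Longrightarrow> n \<noteq> 0 \<Longrightarrow> parent M n \<in> nodes M"
    and stage_Suc: "n \<in> nodes M \<Longrightarrow> n \<noteq> 0 \<Longrightarrow> stage M n = Suc (stage M (parent M n))"
    and ex_interval: "n \<in> nodes M \<Longrightarrow> \<exists>a b. a \<le> b \<and> node_periods M n = {a..b}"
    and root_periods: "node_periods M 0 = {0}"
    and periods_less: "k \<in> nodes M \<Longrightarrow> n \<in> nodes M \<Longrightarrow> (k, n) \<in> (edges M)\<^sup>+ \<Longrightarrow>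
      s \<in> node_periods M k \<Longrightarrow> t \<in> node_periods M n \<Longrightarrow> s < t"
proof -
  have "\<forall>n\<in>nodes M - {0}. parent M n \<in> nodes M"
    "\<forall>n\<in>nodes M - {0}. stage M n = Suc (stage M (parent M n))"
    "\<forall>n\<in>nodes M. \<exists>a b. a \<le> b \<and> node_periods M n = {a..b}"
    "node_periods M 0 = {0}"
    "\<forall>k\<in>nodes M. \<forall>n\<in>nodes M. (k, n) \<in> (edges M)\<^sup>+ \<longrightarrow>
        (\<forall>s\<in>node_periods M k. \<forall>t\<in>node_periods M n. s < t)"
    using assms unfolding scenario_tree_def by - (elim conjE, assumption)+
  then show "n \<in> nodes M \<Longrightarrow> n \<noteq> 0 \<Longrightarrow> parent M n \<in> nodes M"
    and "n \<in> nodes M \<Longrightarrow> n \<noteq> 0 \<Longrightarrow> stage M n = Suc (stage M (parent M n))"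
    and "n \<in> nodes M \<Longrightarrow> \<exists>a b. a \<le> b \<and> node_periods M n = {a..b}"
    and "node_periods M 0 = {0}"
    and "k \<in> nodes M \<Longrightarrow> n \<in> nodes M \<Longrightarrow> (k, n) \<in> (edges M)\<^sup>+ \<Longrightarrow>
      s \<in> node_periods M k \<Longrightarrow> t \<in> node_periods M n \<Longrightarrow> s < t"
    by - (simp_all)
qed

lemma path_to_subset_nodes:
  assumes "scenario_tree M" "n \<in> nodes M"
  shows "path_to M n \<subseteq> nodes M"
proof
  fix k assume "k \<in> path_to M n"
  then have "(k, n) \<in> (edges M)\<^sup>*" by (simp add: path_to_def)
  then show "k \<in> nodes M"
    by (induction rule: converse_rtrancl_induct)
      (simp_all add: assms edges_iff parent_in_nodes[OF assms(1)])
qed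

lemma root_in_path: "scenario_tree M \<Longrightarrow> n \<in> nodes M \<Longrightarrow> 0 \<in> path_to M n"
  by (simp add: scenario_tree_def path_to_def)

lemma periods_increasing:
  assumes "scenario_tree M" "n \<in> nodes M" "k \<in> path_to M n" "k \<noteq> n"
    and "s \<in> node_periods M k" "t \<in> node_periods M n"
  shows "s < t"
proof -
  have "(k, n) \<in> (edges M)\<^sup>+"
    using assms(3,4) by (auto simp: path_to_def rtrancl_eq_or_trancl)
  moreover have "k \<in> nodes M" using path_to_subset_nodes[OF assms(1,2)] assms(3) by auto
  ultimately show ?thesis using periods_less[OF assms(1)] assms(2,5,6) by blast
qed

text \<open>The stage strictly increases along edges, so a descendant of maximal stage is a leaf.\<close>

lemma ex_leaf_below:
  assumes "scenario_tree M" "n \<in> nodes M"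
  obtains l where "l \<in> leaves M" "n \<in> path_to M l"
proof -
  let ?D = "{l \<in> nodes M. n \<in> path_to M l}"
  have fin: "finite ?D" by (simp add: finite_nodes)
  have ne: "?D \<noteq> {}" using assms(2) path_to_self by auto
  obtain l where l: "l \<in> ?D" and max: "\<forall>l'\<in>?D. stage M l' \<le> stage M l"
  proof -
    have "Max (stage M ` ?D) \<in> stage M ` ?D" using fin ne by (intro Max_in) auto
    then obtain l where "l \<in> ?D" "stage M l = Max (stage M ` ?D)" by auto
    then show thesis using fin by (intro that[of l]) auto
  qed
  have "l \<in> leaves M"
  proof (rule ccontr)
    assume "l \<notin> leaves M"
    then obtain c where c: "c \<in> nodes M" "c \<noteq> 0" "parent M c = l"
      using l by (auto simp: leaves_def children_eq)
    have "(l, c) \<in> edges M" using c by (simp add: edges_iff)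
    then have "c \<in> ?D" using l c by (auto simp: path_to_def)
    moreover have "stage M c = Suc (stage M l)" using stage_Suc[OF assms(1)] c by auto
    ultimately show False using max by fastforce
  qed
  then show thesis using l that by auto
qed

lemma path_through_props:
  assumes "scenario_tree M" "n \<in> nodes M"
  shows "path_through M n \<in> scenarios M" "n \<in> path_through M n"
proof -
  obtain l where "l \<in> leaves M" "n \<in> path_to M l" using ex_leaf_below[OF assms] .
  then have "\<exists>\<omega>. \<omega> \<in> scenarios M \<and> n \<in> \<omega>" by (auto simp: scenarios_def)
  from someI_ex[OF this] show "path_through M n \<in> scenarios M" "n \<in> path_through M n"
    by (auto simp: path_through_def)
qed

lemma scenario_nodes:
  assumes "scenario_tree M" "\<omega> \<in> scenarios M"
  shows "\<omega> \<subseteq> nodes M"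
  using assms path_to_subset_nodes[OF assms(1)] by (auto simp: scenarios_def leaves_def)

lemma scenario_closed:
  assumes "\<omega> \<in> scenarios M" "n \<in> \<omega>"
  shows "path_to M n \<subseteq> \<omega>"
  using assms by (auto simp: scenarios_def intro: path_to_trans)

lemma node_periods_subset:
  assumes "scenario_tree M" "n \<in> nodes M"
  shows "node_periods M n \<subseteq> periods M"
proof -
  obtain l where "l \<in> leaves M" "n \<in> path_to M l" using ex_leaf_below[OF assms] .
  moreover from this have "(\<Union>k\<in>path_to M l. node_periods M k) = periods M"
    using assms(1) by (simp add: scenario_tree_def)
  ultimately show ?thesis by auto
qed

lemma node_periods_interval:
  assumes "scenario_tree M" "n \<in> nodes M"
  obtains a b where "a \<le> b" "node_periods M n = {a..b}"
  using ex_interval[OF assms] by blast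

lemma node_periods_finite:
  assumes "scenario_tree M" "n \<in> nodes M"
  shows "finite (node_periods M n)"
  using node_periods_interval[OF assms] by (metis finite_atLeastAtMost)

lemma first_period_in:
  assumes "scenario_tree M" "n \<in> nodes M"
  shows "first_period M n \<in> node_periods M n"
proof -
  obtain a b where "a \<le> b" "node_periods M n = {a..b}" using node_periods_interval[OF assms] .
  then show ?thesis unfolding first_period_def
    by (metis Min_in atLeastatMost_empty_iff2 finite_atLeastAtMost leD)
qed

text \<open>The periods up to the last one of a node are covered by the path to that node: on a path to
  a leaf below it they cannot belong to later nodes, whose periods are larger.\<close>

lemma ex_node_at:
  assumes tree: "scenario_tree M" and n: "n \<in> nodes M"
    and t': "t' \<in> node_periods M n" and le: "t \<le> t'"
  shows "\<exists>!k. k \<in> path_to M n \<and> t \<in> node_periods M k"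
proof -
  obtain l where l: "l \<in> leaves M" "n \<in> path_to M l" using ex_leaf_below[OF tree n] .
  have "t \<in> periods M" using node_periods_subset[OF tree n] t' le by (auto simp: periods_def)
  moreover have "(\<Union>k\<in>path_to M l. node_periods M k) = periods M"
    using tree l by (simp add: scenario_tree_def)
  ultimately obtain k where k: "k \<in> path_to M l" "t \<in> node_periods M k" by auto
  have lN: "l \<in> nodes M" using l by (simp add: leaves_def)
  have kN: "k \<in> nodes M" using path_to_subset_nodes[OF tree lN] k by auto
  have kp: "k \<in> path_to M n"
  proof (rule ccontr)
    assume no: "k \<notin> path_to M n"
    then have "n \<in> path_to M k" using path_to_linear[OF k(1) l(2)] by auto
    moreover have "n \<noteq> k" using no path_to_self by auto
    ultimately have "t' < t" using periods_increasing[OF tree kN] t' k(2) by auto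
    then show False using le by simp
  qed
  have "k' = k" if k': "k' \<in> path_to M n" "t \<in> node_periods M k'" for k'
  proof (rule ccontr)
    assume ne: "k' \<noteq> k"
    have k'N: "k' \<in> nodes M" using path_to_subset_nodes[OF tree n] k' by auto
    from path_to_linear[OF k'(1) kp] show False
      using periods_increasing[OF tree kN, of k' t t] periods_increasing[OF tree k'N, of k t t]
        ne k' k by auto
  qed
  then show ?thesis using kp k(2) by blast
qed

lemma node_at_props:
  assumes "scenario_tree M" "n \<in> nodes M" "t' \<in> node_periods M n" "t \<le> t'"
  shows "node_at M t n \<in> path_to M n" "t \<in> node_periods M (node_at M t n)"
  using theI'[OF ex_node_at[OF assms]] by (auto simp: node_at_def)

lemma first_period_pos:
  assumes "scenario_tree M" "n \<in> nodes M" "n \<noteq> 0"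
  shows "0 < first_period M n"
proof -
  have "0 \<in> node_periods M 0" using root_periods[OF assms(1)] by simp
  with periods_increasing[OF assms(1,2) root_in_path[OF assms(1,2)]] assms first_period_in
  show ?thesis by metis
qed

lemma first_period_le:
  assumes "scenario_tree M" "n \<in> nodes M" "t \<in> node_periods M n"
  shows "first_period M n \<le> t"
  unfolding first_period_def by (rule Min_le[OF node_periods_finite[OF assms(1,2)] assms(3)])

text \<open>The period \<open>c - 1\<close> before the first period \<open>c\<close> of a node is covered by a proper ancestor. All periods
  of the parent lie below \<open>c\<close>, and those of earlier ancestors lie below all periods of the parent, so
  that ancestor can only be the parent.\<close>

lemma parent_last_period:
  assumes tree: "scenario_tree M" and n: "n \<in> nodes M" "n \<noteq> 0"
  shows "last_period M (parent M n) = first_period M n - 1"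
proof -
  define m where "m = parent M n"
  define c where "c = first_period M n"
  have c: "c \<in> node_periods M n" "0 < c"
    using first_period_in first_period_pos assms by (auto simp: c_def)
  have mN: "m \<in> nodes M" using parent_in_nodes[OF tree n] by (simp add: m_def)
  have mp: "m \<in> path_to M n" using n by (auto simp: m_def path_to_def edges_iff)
  have "stage M n = Suc (stage M m)" using stage_Suc[OF tree n] by (simp add: m_def)
  then have mn: "m \<noteq> n" by auto
  obtain a b where ab: "a \<le> b" "node_periods M m = {a..b}" using node_periods_interval[OF tree mN] .
  have last: "last_period M m = b"
    unfolding last_period_def ab(2) using ab(1) by (intro Max_eqI) auto
  have "b < c" using periods_increasing[OF tree n(1) mp mn _ c(1)] ab by auto
  obtain k where k: "k \<in> path_to M n" "c - 1 \<in> node_periods M k"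
    using ex_node_at[OF tree n(1) c(1), of "c - 1"] by auto
  have "k \<noteq> n" using k(2) c first_period_le[OF tree n(1), of "c - 1"] by (auto simp: c_def)
  then have km: "k \<in> path_to M m" using path_to_parent k(1) by (simp add: m_def)
  have "k = m"
  proof (rule ccontr)
    assume "k \<noteq> m"
    then have "c - 1 < a" using periods_increasing[OF tree mN km _ k(2)] ab by auto
    then show False using \<open>b < c\<close> ab by simp
  qed
  then have "c - 1 \<le> b" using k ab by simp
  then show ?thesis using \<open>b < c\<close> last by (simp add: m_def c_def)
qed

section \<open>Passing between path copies and the tree assignment\<close>

text \<open>The constraints at a node \<open>n\<close> refer to the investments only on the path to \<open>n\<close>, and there only
  at the periods of each node.\<close>

definition inv_agree :: "'u mssp_data \<Rightarrow> 'u investment \<Rightarrow> 'u investment \<Rightarrow> nat \<Rightarrow> bool" where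
  "inv_agree M x x' n \<longleftrightarrow>
     (\<forall>k\<in>path_to M n. \<forall>t\<in>node_periods M k. \<forall>u\<in>techs M. x u t k = x' u t k)"

lemma inv_agree_node_at:
  assumes "scenario_tree M" "n \<in> nodes M" "inv_agree M x x' n"
    and "t' \<in> node_periods M n" "t \<in> active M u t'" "u \<in> techs M"
  shows "x u t (node_at M t n) = x' u t (node_at M t n)"
proof -
  have "t \<le> t'" using assms(5) by (simp add: active_def)
  from node_at_props[OF assms(1,2,4) this] assms(3,6) show ?thesis by (simp add: inv_agree_def)
qed

lemma inv_agree_self:
  "inv_agree M x x' n \<Longrightarrow> t \<in> node_periods M n \<Longrightarrow> u \<in> techs M \<Longrightarrow> x u t n = x' u t n"
  by (simp add: inv_agree_def path_to_self)

lemma node_constraints_cong: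
  assumes "scenario_tree M" "n \<in> nodes M" "inv_agree M x x' n"
  shows "node_constraints M x y n = node_constraints M x' y n"
proof -
  note agree = inv_agree_node_at[OF assms]
  have "supply_met M x y n = supply_met M x' y n"
    unfolding supply_met_def
    by (intro ball_cong refl all_cong1 arg_cong[where f = "\<lambda>z. _ \<le> _ + z"] sum.cong
        arg_cong[where f = "\<lambda>z. _ * real z"] agree) (auto simp: techs_def)
  moreover have "storage_capacity M x y n = storage_capacity M x' y n"
    unfolding storage_capacity_def
    by (intro ball_cong refl all_cong1 arg_cong[where f = "\<lambda>z. _ \<le> z"] sum.cong
        arg_cong[where f = "\<lambda>z. _ * real z"] agree) (auto simp: techs_def)
  moreover have "transfer_capacity M x y n = transfer_capacity M x' y n"
    unfolding transfer_capacity_def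
    by (intro ball_cong refl arg_cong[where f = "\<lambda>z. _ \<le> _ * real z"] agree) (auto simp: techs_def)
  ultimately show ?thesis by (simp add: node_constraints_def)
qed

lemma inv_agree_tree_inv:
  assumes tree: "scenario_tree M" and na: "inv_nonanticipative M xs"
    and \<omega>: "\<omega> \<in> scenarios M" "n \<in> \<omega>"
  shows "inv_agree M (xs \<omega>) (tree_inv M xs) n"
  unfolding inv_agree_def
proof (intro ballI)
  fix k t u assume k: "k \<in> path_to M n" and t: "t \<in> node_periods M k" and u: "u \<in> techs M"
  have k\<omega>: "k \<in> \<omega>" using scenario_closed[OF \<omega>] k by auto
  then have kN: "k \<in> nodes M" using scenario_nodes[OF tree \<omega>(1)] by auto
  show "xs \<omega> u t k = tree_inv M xs u t k"
    using na \<omega>(1) k\<omega> path_through_props[OF tree kN] t u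
    unfolding inv_nonanticipative_def tree_inv_def by blast
qed

lemma inv_feasible_tree_inv:
  assumes tree: "scenario_tree M" and na: "inv_nonanticipative M xs"
    and feas: "\<And>\<omega>. \<omega> \<in> scenarios M \<Longrightarrow> inv_feasible M \<omega> (xs \<omega>)"
  shows "inv_feasible M (nodes M) (tree_inv M xs)"
proof -
  have main: "(n \<noteq> 0 \<longrightarrow> (\<Sum>u\<in>techs M. inst_cost M u n * real (tree_inv M xs u t n)) \<le> budget M t) \<and>
      (n \<noteq> 0 \<longrightarrow> (\<Sum>u\<in>techs M. \<Sum>t'\<in>active M u t.
          footprint M u t' * real (tree_inv M xs u t' (node_at M t' n))) \<le> area M t) \<and>
      (\<forall>u\<in>techs M. int (tree_inv M xs u t n) \<le> \<lfloor>budget M t / inst_cost M u n\<rfloor>)"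
    if n: "n \<in> nodes M" and t: "t \<in> node_periods M n" for n t
  proof -
    let ?\<omega> = "path_through M n"
    note \<omega> = path_through_props[OF tree n]
    note ag = inv_agree_tree_inv[OF tree na \<omega>]
    have 1: "(\<Sum>u\<in>techs M. inst_cost M u n * real (tree_inv M xs u t n))
        = (\<Sum>u\<in>techs M. inst_cost M u n * real (xs ?\<omega> u t n))"
      using inv_agree_self[OF ag t] by (intro sum.cong) auto
    have 2: "(\<Sum>u\<in>techs M. \<Sum>t'\<in>active M u t.
          footprint M u t' * real (tree_inv M xs u t' (node_at M t' n)))
        = (\<Sum>u\<in>techs M. \<Sum>t'\<in>active M u t.
          footprint M u t' * real (xs ?\<omega> u t' (node_at M t' n)))"
      using inv_agree_node_at[OF tree n ag t] by (intro sum.cong) auto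
    have 3: "tree_inv M xs u t n = xs ?\<omega> u t n" if "u \<in> techs M" for u
      using inv_agree_self[OF ag t that] by simp
    show ?thesis unfolding 1 2 using 3 feas[OF \<omega>(1)] \<omega>(2) t
      by (auto simp: inv_feasible_def)
  qed
  have "0 \<in> nodes M" by (simp add: nodes_def)
  from path_through_props[OF tree this] feas
  have "\<forall>u\<in>techs M. tree_inv M xs u 0 0 = initial_inst M u"
    by (auto simp: inv_feasible_def tree_inv_def)
  then show ?thesis unfolding inv_feasible_def using main by auto
qed

section \<open>Repairing the storage balance\<close>

text \<open>The balance residual between \<open>n\<close> and its parent; it is set to 0 at the root, which has no
  incoming balance constraint.\<close>

definition entry_residual :: "'u mssp_data \<Rightarrow> 'u operation \<Rightarrow> resource \<Rightarrow> nat \<Rightarrow> real" where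
  "entry_residual M y r n = (if n = 0 then 0 else balance_residual M y r (parent M n) n)"

text \<open>The repair of \<open>y\<close> acts only in the first sub-period of each node. A positive residual (too
  much stored energy) is covered by purchasing and charging the missing energy, a negative one is
  removed by discharging the surplus. Storage levels are left unchanged, so the repairs at
  different nodes do not interact.\<close>

definition repair :: "'u mssp_data \<Rightarrow> 'u operation \<Rightarrow> 'u operation" where
  "repair M y = y
     \<lparr> purchase := (\<lambda>r q t n. purchase y r q t n + (if q = 1 \<and> t = first_period M n
         then max 0 (entry_residual M y r n) / charge_eff M r else 0)),
       charge := (\<lambda>r q t n. charge y r q t n + (if q = 1 \<and> t = first_period M n
         then max 0 (entry_residual M y r n) / charge_eff M r else 0)),
       discharge := (\<lambda>r q t n. discharge y r q t n + (if q = 1 \<and> t = first_period M n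
         then discharge_eff M r * max 0 (- entry_residual M y r n) else 0)) \<rparr>"

lemma eff_pos:
  assumes "valid_parameters M"
  shows "0 < charge_eff M r" "0 < discharge_eff M r"
  using assms by (auto simp: valid_parameters_def)

lemma repair_node_constraints:
  assumes val: "valid_parameters M"
    and leaf: "n \<in> leaves M \<Longrightarrow> first_period M n \<noteq> horizon M"
    and nc: "node_constraints M x y n"
  shows "node_constraints M x (repair M y) n"
proof -
  have pos: "0 \<le> max 0 (entry_residual M y r n) / charge_eff M r"
    "0 \<le> discharge_eff M r * max 0 (- entry_residual M y r n)" for r
    using eff_pos[OF val, of r] by auto
  have "op_nonneg M (repair M y) n"
    using nc pos by (simp add: node_constraints_def op_nonneg_def repair_def)
  moreover have "demand_met M (repair M y) n = demand_met M y n"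
    by (simp add: demand_met_def repair_def)
  moreover have "supply_met M x y n \<Longrightarrow> supply_met M x (repair M y) n"
    unfolding supply_met_def
  proof (intro ballI allI)
    fix t' q r
    assume *: "\<forall>t'\<in>node_periods M n. \<forall>q\<in>subperiods M. \<forall>r. used y r q t' n
        \<le> purchase y r q t' n - charge y r q t' n + discharge y r q t' n
          + (\<Sum>j\<in>gen_techs M. \<Sum>t\<in>active M j t'.
               generation M j r q t t' n * real (x j t (node_at M t n)))"
      and "t' \<in> node_periods M n" "q \<in> subperiods M"
    then have "used y r q t' n
        \<le> purchase y r q t' n - charge y r q t' n + discharge y r q t' n
          + (\<Sum>j\<in>gen_techs M. \<Sum>t\<in>active M j t'.
               generation M j r q t t' n * real (x j t (node_at M t n)))" by blast
    then show "used (repair M y) r q t' n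
        \<le> purchase (repair M y) r q t' n - charge (repair M y) r q t' n
          + discharge (repair M y) r q t' n
          + (\<Sum>j\<in>gen_techs M. \<Sum>t\<in>active M j t'.
               generation M j r q t t' n * real (x j t (node_at M t n)))"
      using pos(2)[of r] by (auto simp: repair_def)
  qed
  moreover have "storage_capacity M x (repair M y) n = storage_capacity M x y n"
    by (simp add: storage_capacity_def repair_def)
  moreover have "transfer_capacity M x (repair M y) n = transfer_capacity M x y n"
    by (simp add: transfer_capacity_def repair_def)
  moreover have "purchase_limit M (repair M y) n = purchase_limit M y n" if "n \<in> leaves M"
    using leaf[OF that] by (simp add: purchase_limit_def repair_def)
  ultimately show ?thesis using nc by (simp add: node_constraints_def)
qed

lemma repair_storage_balance:
  assumes tree: "scenario_tree M" and val: "valid_parameters M"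
    and n: "n \<in> nodes M" "n \<noteq> 0"
    and inner: "inner_storage_balance M y n"
  shows "storage_balance M (repair M y) n"
  unfolding storage_balance_def
proof (intro ballI allI)
  fix t q r assume t: "t \<in> node_periods M n" and q: "q \<in> subperiods M"
  show "balance_at M (repair M y) r q t n"
  proof (cases "q = 1 \<and> t = first_period M n")
    case False
    then have "balance_at M y r q t n" using inner t q by (simp add: inner_storage_balance_def)
    then show ?thesis using False by (auto simp: balance_at_def repair_def split: prod.splits)
  next
    case True
    \<comment> \<open>The first period of a non-root node is positive, so subtracting 1 does not truncate and leads
      to the parent.\<close>
    have "first_period M n - 1 \<notin> node_periods M n"
      using first_period_le[OF tree n(1)] first_period_pos[OF tree n] by fastforce
    then have prec: "preceding M q t n = (num_subperiods M, last_period M (parent M n), parent M n)"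
      using True parent_last_period[OF tree n] by (simp add: preceding_def)
    define d where "d = balance_residual M y r (parent M n) n"
    have "charge_eff M r * (c + max 0 d / charge_eff M r) = charge_eff M r * c + max 0 d"
      "(c + discharge_eff M r * max 0 (- d)) / discharge_eff M r = c / discharge_eff M r + max 0 (- d)"
      for c using eff_pos[OF val, of r] by (simp_all add: field_simps)
    moreover have "stored y r 1 (first_period M n) n =
        retention M r * stored y r (num_subperiods M) (last_period M (parent M n)) (parent M n)
        + (charge_eff M r * charge y r 1 (first_period M n) n + max 0 d)
        - (discharge y r 1 (first_period M n) n / discharge_eff M r + max 0 (- d))"
      by (simp add: d_def balance_residual_def)
    ultimately show ?thesis
      using True prec n by (simp add: balance_at_def repair_def entry_residual_def flip: d_def)
  qed
qed

lemma repair_node_cost: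
  assumes tree: "scenario_tree M" and val: "valid_parameters M" and n: "n \<in> nodes M" "n \<noteq> 0"
  shows "node_cost M n (repair M y) = node_cost M n y
    + (\<Sum>r\<in>UNIV. discount M ^ (first_period M n - 1) * price M r (first_period M n)
        / charge_eff M r * max 0 (balance_residual M y r (parent M n) n))"
proof -
  define e where "e r = max 0 (balance_residual M y r (parent M n) n) / charge_eff M r" for r
  have one: "1 \<in> subperiods M" "finite (subperiods M)"
    using val by (auto simp: valid_parameters_def subperiods_def)
  have "node_cost M n (repair M y) = node_cost M n y
      + (\<Sum>t\<in>node_periods M n. \<Sum>r\<in>UNIV. \<Sum>q\<in>subperiods M.
          (if q = 1 then if t = first_period M n
             then discount M ^ (t - 1) * price M r t * e r else 0 else 0))"
    using n unfolding node_cost_def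
    by (simp add: repair_def sum.distrib[symmetric] distrib_left)
      (intro sum.cong, auto simp: entry_residual_def e_def)
  also have "(\<Sum>t\<in>node_periods M n. \<Sum>r\<in>UNIV. \<Sum>q\<in>subperiods M.
          (if q = 1 then if t = first_period M n
             then discount M ^ (t - 1) * price M r t * e r else 0 else 0))
      = (\<Sum>t\<in>node_periods M n. if t = first_period M n
          then \<Sum>r\<in>UNIV. discount M ^ (t - 1) * price M r t * e r else 0)"
    using one by (intro sum.cong) (auto simp: sum.delta)
  also have "\<dots> = (\<Sum>r\<in>UNIV. discount M ^ (first_period M n - 1)
      * price M r (first_period M n) * e r)"
    using first_period_in[OF tree n(1)] node_periods_finite[OF tree n(1)] by (simp add: sum.delta')
  finally show ?thesis by (simp add: e_def)
qed

lemma leaf_first_period_neq_horizon: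
  assumes tree: "scenario_tree M" and n: "n \<in> leaves M"
    and card: "1 < card (node_periods M n)"
  shows "first_period M n \<noteq> horizon M"
proof -
  have nN: "n \<in> nodes M" using n by (simp add: leaves_def)
  obtain t where t: "t \<in> node_periods M n" "t \<noteq> first_period M n"
    using card first_period_in[OF tree nN]
    by (metis card_1_singleton_iff is_singletonI' is_singleton_altdef less_irrefl empty_iff)
  then have "first_period M n < t" using first_period_le[OF tree nN t(1)] by simp
  moreover have "t \<le> horizon M" using node_periods_subset[OF tree nN] t by (auto simp: periods_def)
  ultimately show ?thesis by simp
qed

section \<open>Objective values\<close>

text \<open>The investment part of the discounted cost at a node; the purchase part is \<open>node_cost\<close>.\<close>

definition inv_cost :: "'u mssp_data \<Rightarrow> nat \<Rightarrow> 'u investment \<Rightarrow> real" where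
  "inv_cost M n x = (\<Sum>t\<in>node_periods M n. discount M ^ (t - 1)
     * (\<Sum>u\<in>techs M. (inst_cost M u n + om_cost M u t) * real (x u t n)))"

lemma node_total_cost:
  assumes "n \<noteq> 0"
  shows "(\<Sum>t\<in>node_periods M n. discount M ^ (t - 1) * period_cost M x y t n)
    = inv_cost M n x + node_cost M n y"
  using assms
  by (simp add: inv_cost_def node_cost_def period_cost_def distrib_left sum.distrib
      sum_distrib_left mult.assoc)

lemma inv_cost_cong: "inv_agree M x x' n \<Longrightarrow> inv_cost M n x = inv_cost M n x'"
  unfolding inv_cost_def by (intro sum.cong refl arg_cong2[where f = "(*)"]) (simp add: inv_agree_self)

lemma mssp_objective_eq:
  "mssp_objective M x y
    = (\<Sum>n\<in>nodes M - {0}. node_prob M n * (inv_cost M n x + node_cost M n y))"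
  unfolding mssp_objective_def
  by (intro sum.cong refl) (simp add: node_total_cost[symmetric] sum_distrib_left mult.assoc)

lemma relaxed_objective_eq:
  assumes tree: "scenario_tree M" and na: "inv_nonanticipative M xs"
  shows "relaxed_objective M xs ys = (\<Sum>n\<in>nodes M - {0}. \<Sum>\<omega>\<in>{\<omega> \<in> scenarios M. n \<in> \<omega>}.
      scenario_prob M \<omega> * (inv_cost M n (tree_inv M xs) + node_cost M n (ys \<omega>)))"
proof -
  have "relaxed_objective M xs ys = (\<Sum>\<omega>\<in>scenarios M. \<Sum>n\<in>{n \<in> nodes M - {0}. n \<in> \<omega>}.
      scenario_prob M \<omega> * (inv_cost M n (tree_inv M xs) + node_cost M n (ys \<omega>)))"
    unfolding relaxed_objective_def
  proof (intro sum.cong refl)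
    fix \<omega> assume \<omega>: "\<omega> \<in> scenarios M"
    have "path_objective M \<omega> (xs \<omega>) (ys \<omega>)
        = (\<Sum>n\<in>{n \<in> nodes M - {0}. n \<in> \<omega>}. inv_cost M n (tree_inv M xs) + node_cost M n (ys \<omega>))"
      unfolding path_objective_def
    proof (intro sum.cong)
      show "\<omega> - {0} = {n \<in> nodes M - {0}. n \<in> \<omega>}" using scenario_nodes[OF tree \<omega>] by auto
      fix n assume n: "n \<in> {n \<in> nodes M - {0}. n \<in> \<omega>}"
      then show "(\<Sum>t\<in>node_periods M n. discount M ^ (t - 1) * period_cost M (xs \<omega>) (ys \<omega>) t n)
          = inv_cost M n (tree_inv M xs) + node_cost M n (ys \<omega>)"
        using node_total_cost[of n M "xs \<omega>" "ys \<omega>"]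
          inv_cost_cong[OF inv_agree_tree_inv[OF tree na \<omega>], of n] by simp
    qed
    then show "scenario_prob M \<omega> * path_objective M \<omega> (xs \<omega>) (ys \<omega>)
        = (\<Sum>n\<in>{n \<in> nodes M - {0}. n \<in> \<omega>}.
            scenario_prob M \<omega> * (inv_cost M n (tree_inv M xs) + node_cost M n (ys \<omega>)))"
      by (simp add: sum_distrib_left)
  qed
  also have "\<dots> = (\<Sum>n\<in>nodes M - {0}. \<Sum>\<omega>\<in>{\<omega> \<in> scenarios M. n \<in> \<omega>}.
      scenario_prob M \<omega> * (inv_cost M n (tree_inv M xs) + node_cost M n (ys \<omega>)))"
    by (rule sum.swap_restrict) (simp_all add: finite_nodes finite_scenarios)
  finally show ?thesis .
qed

lemma node_problem_relaxes_path_problem: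
  assumes tree: "scenario_tree M" and na: "inv_nonanticipative M xs"
    and \<omega>: "\<omega> \<in> scenarios M" "n \<in> \<omega>" and feas: "op_feasible M \<omega> (xs \<omega>) y"
  shows "node_feasible M (tree_inv M xs) n y"
proof -
  have nN: "n \<in> nodes M" using scenario_nodes[OF tree \<omega>(1)] \<omega>(2) by auto
  show ?thesis
    using feas \<omega>(2)
    by (simp add: node_constraints_cong[OF tree nN inv_agree_tree_inv[OF tree na \<omega>], symmetric]
        op_feasible_def node_feasible_def storage_balance_def inner_storage_balance_def)
qed

lemma nodewise_objective_le:
  assumes tree: "scenario_tree M" and val: "valid_parameters M"
    and feas: "relaxed_feasible M xs ys"
    and nodewise: "nodewise_solution M (tree_inv M xs) y"
  shows "mssp_objective M (tree_inv M xs) y \<le> relaxed_objective M xs ys"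
proof -
  have na: "inv_nonanticipative M xs" using feas by (simp add: relaxed_feasible_def)
  show ?thesis
    \<comment> \<open>With the node probability written as a sum, both sides run over the pairs of a node and a path
      through it.\<close>
    unfolding mssp_objective_eq relaxed_objective_eq[OF tree na] node_prob_def sum_distrib_right
  proof (intro sum_mono mult_left_mono add_left_mono)
    fix n \<omega> assume n: "n \<in> nodes M - {0}" and \<omega>: "\<omega> \<in> {\<omega> \<in> scenarios M. n \<in> \<omega>}"
    have "node_feasible M (tree_inv M xs) n (ys \<omega>)"
      using feas \<omega> by (intro node_problem_relaxes_path_problem[OF tree na, of \<omega>])
        (auto simp: relaxed_feasible_def)
    then show "node_cost M n y \<le> node_cost M n (ys \<omega>)"
      using nodewise n by (auto simp: nodewise_solution_def)
    show "0 \<le> scenario_prob M \<omega>" using val \<omega> by (simp add: valid_parameters_def)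
  qed
qed

lemma sum_over_tree_edges:
  assumes "scenario_tree M"
  shows "(\<Sum>n\<in>nodes M - leaves M. \<Sum>n'\<in>children M n. f n n')
    = (\<Sum>n\<in>nodes M - {0}. f (parent M n) n)"
proof -
  have "(\<Sum>n\<in>nodes M - leaves M. \<Sum>n'\<in>children M n. f n n')
      = (\<Sum>n\<in>nodes M - leaves M. \<Sum>n'\<in>{n' \<in> nodes M - {0}. parent M n' = n}. f (parent M n') n')"
    unfolding children_eq by (intro sum.cong refl) auto
  also have "\<dots> = (\<Sum>n\<in>nodes M - {0}. f (parent M n) n)"
    using parent_in_nodes[OF assms]
    by (intro sum.group) (auto simp: finite_nodes leaves_def children_eq)
  finally show ?thesis .
qed

lemma repair_objective:
  assumes tree: "scenario_tree M" and val: "valid_parameters M"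
  shows "mssp_objective M x (repair M y) = mssp_objective M x y
    + (\<Sum>r\<in>UNIV. \<Sum>n\<in>nodes M - leaves M. \<Sum>n'\<in>children M n.
        node_prob M n' * discount M ^ (first_period M n' - 1)
          * price M r (first_period M n') / charge_eff M r
          * max 0 (balance_residual M y r n n'))"
proof -
  have "mssp_objective M x (repair M y) = mssp_objective M x y
      + (\<Sum>n\<in>nodes M - {0}. \<Sum>r\<in>UNIV. node_prob M n * discount M ^ (first_period M n - 1)
          * price M r (first_period M n) / charge_eff M r
          * max 0 (balance_residual M y r (parent M n) n))"
    unfolding mssp_objective_eq sum.distrib[symmetric]
    by (intro sum.cong refl)
      (simp add: repair_node_cost[OF tree val] distrib_left sum_distrib_left mult.assoc)
  then show ?thesis
    unfolding sum_over_tree_edges[OF tree] by (subst sum.swap)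
qed

theorem proposition3:
  fixes M :: "'u mssp_data"
    and xs :: "nat set \<Rightarrow> 'u investment"
    and ys :: "nat set \<Rightarrow> 'u operation"
    and yt :: "'u operation"
  assumes "mssp_instance M"
    and "\<forall>n\<in>nodes M. stage M n = num_stages M \<longrightarrow> card (node_periods M n) > 1"
    and "relaxed_feasible M xs ys"
    and "nodewise_solution M (tree_inv M xs) yt"
  shows "\<exists>yh :: nat set \<Rightarrow> 'u operation.
           nonanticipative M xs yh \<and>
           mssp_feasible M (tree_inv M xs) (tree_op M yh) \<and>
           mssp_objective M (tree_inv M xs) (tree_op M yh) - relaxed_objective M xs ys
             \<le> (\<Sum>r\<in>UNIV. \<Sum>n\<in>nodes M - leaves M. \<Sum>n'\<in>children M n.
                  node_prob M n' * discount M ^ (first_period M n' - 1)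
                    * price M r (first_period M n') / charge_eff M r
                    * max 0 (balance_residual M yt r n n'))"
proof -
  have tree: "scenario_tree M" and val: "valid_parameters M"
    using assms(1) by (auto simp: mssp_instance_def)
  have na: "inv_nonanticipative M xs" using assms(3) by (simp add: relaxed_feasible_def)
  define yh where "yh = (\<lambda>\<omega> :: nat set. repair M yt)"
  have yh: "tree_op M yh = repair M yt" by (simp add: tree_op_def yh_def)
  have "nonanticipative M xs yh"
    using na by (simp add: nonanticipative_def op_nonanticipative_def yh_def)
  moreover have "op_feasible M (nodes M) (tree_inv M xs) (repair M yt)"
    unfolding op_feasible_def
  proof (intro ballI conjI impI)
    fix n assume n: "n \<in> nodes M"
    then have nf: "node_feasible M (tree_inv M xs) n yt"
      using assms(4) by (simp add: nodewise_solution_def)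
    show "node_constraints M (tree_inv M xs) (repair M yt) n"
    proof (rule repair_node_constraints[OF val])
      show "node_constraints M (tree_inv M xs) yt n" using nf by (simp add: node_feasible_def)
      assume leaf: "n \<in> leaves M"
      then have "stage M n = num_stages M" using tree by (simp add: scenario_tree_def)
      then show "first_period M n \<noteq> horizon M"
        using assms(2) n by (intro leaf_first_period_neq_horizon[OF tree leaf]) auto
    qed
    show "storage_balance M (repair M yt) n" if "n \<noteq> 0"
      using repair_storage_balance[OF tree val n that] nf that by (simp add: node_feasible_def)
  qed
  then have "mssp_feasible M (tree_inv M xs) (tree_op M yh)"
    using inv_feasible_tree_inv[OF tree na] assms(3)
    by (simp add: mssp_feasible_def yh relaxed_feasible_def)
  moreover have "mssp_objective M (tree_inv M xs) (tree_op M yh) - relaxed_objective M xs ys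
      \<le> (\<Sum>r\<in>UNIV. \<Sum>n\<in>nodes M - leaves M. \<Sum>n'\<in>children M n.
          node_prob M n' * discount M ^ (first_period M n' - 1)
            * price M r (first_period M n') / charge_eff M r
            * max 0 (balance_residual M yt r n n'))"
    using nodewise_objective_le[OF tree val assms(3,4)]
    by (simp only: yh repair_objective[OF tree val])
  ultimately show ?thesis by blast
qed

end
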